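(* Let $n\geq 0$ be an integer with $n\neq 0,1,3,7$, and let $A=\mathbb{R}[X_0,X_1,\ldots,X_n]$ be the polynomial ring in $n+1$ variables over the field of real numbers. Let $f=\sum_{i=0}^n X_i^2-1\in A$ and let $I=Af$ be the principal ideal generated by $f$. Then the images of $X_0f,X_1f,\ldots,X_nf$ in $I/I^2$ generate $I/I^2$, but this set of generators of $I/I^2$ does not lift to a set of generators of $I$; that is, there do not exist $g_0,g_1,\ldots,g_n\in I$ such that $I=(g_0,g_1,\ldots,g_n)$ and $g_i-X_if\in I^2$ for all $i=0,1,\ldots,n$.
   Context: Generators $\overline{a_0},\ldots,\overline{a_n}$ of $I/I^2$ (as a module) are said to lift to a set of generators of $I$ if there are $g_0,\ldots,g_n\in I$ generating the ideal $I$ such that the image of $g_i$ in $I/I^2$ is $\overline{a_i}$ for each $i$. *)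

theory Defs
  imports Complex_Main "HOL-Algebra.QuotRing" "HOL-Algebra.Ideal_Product" "HOL-Algebra.Module" "HOL-Library.Poly_Mapping"
begin

text \<open>
  Monomials are finitely supported exponent functions \<open>nat \<Rightarrow>\<^sub>0 nat\<close>, and
  \<open>(nat \<Rightarrow>\<^sub>0 nat) \<Rightarrow>\<^sub>0 'a\<close> with its convolution product is the polynomial ring in countably
  many variables; restricting the carrier gives the polynomial ring in the variables
  with index in a set \<open>V\<close>.
\<close>

definition mpoly_ring :: "nat set \<Rightarrow> ((nat \<Rightarrow>\<^sub>0 nat) \<Rightarrow>\<^sub>0 'a::comm_ring_1) ring" where
  "mpoly_ring V =
    \<lparr>carrier = {p. \<forall>m \<in> Poly_Mapping.keys p. Poly_Mapping.keys m \<subseteq> V},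
     monoid.mult = (*), one = 1, ring.zero = 0, add = (+)\<rparr>"

definition mpoly_var :: "nat \<Rightarrow> (nat \<Rightarrow>\<^sub>0 nat) \<Rightarrow>\<^sub>0 'a::comm_ring_1" where
  "mpoly_var i = Poly_Mapping.single (Poly_Mapping.single i 1) 1"

lemma cring_mpoly_ring: "cring (mpoly_ring V)"
proof -
  let ?R = "mpoly_ring V :: ((nat \<Rightarrow>\<^sub>0 nat) \<Rightarrow>\<^sub>0 'a) ring"
  have add_cl: "p + q \<in> carrier ?R" if "p \<in> carrier ?R" "q \<in> carrier ?R" for p q
    using that Poly_Mapping.keys_add[of p q] by (auto simp: mpoly_ring_def subset_iff)
  have mult_cl: "p * q \<in> carrier ?R" if p: "p \<in> carrier ?R" and q: "q \<in> carrier ?R" for p q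
  proof -
    have "Poly_Mapping.keys m \<subseteq> V" if m: "m \<in> Poly_Mapping.keys (p * q)" for m
    proof -
      obtain a b where "m = a + b" "a \<in> Poly_Mapping.keys p" "b \<in> Poly_Mapping.keys q"
        using m Poly_Mapping.keys_mult[of p q] by blast
      with p q show ?thesis
        using Poly_Mapping.keys_add[of a b] by (auto simp: mpoly_ring_def subset_iff)
    qed
    then show ?thesis by (simp add: mpoly_ring_def)
  qed
  have neg: "- p \<in> carrier ?R" if "p \<in> carrier ?R" for p
    using that by (simp add: mpoly_ring_def)
  have one: "1 \<in> carrier ?R"
    by (simp add: mpoly_ring_def flip: single_one)
  have zero: "0 \<in> carrier ?R"
    by (simp add: mpoly_ring_def)
  have simps: "add ?R = (+)" "monoid.mult ?R = (*)" "monoid.one ?R = 1" "ring.zero ?R = 0"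
    by (simp_all add: mpoly_ring_def)
  show ?thesis
  proof (rule cringI)
    show "abelian_group ?R"
      by (rule abelian_groupI)
        (auto simp: simps add_cl zero algebra_simps intro!: bexI[OF _ neg])
    show "Group.comm_monoid ?R"
      by (rule comm_monoidI) (auto simp: simps mult_cl one algebra_simps)
  qed (simp add: simps algebra_simps)
qed

lemma mpoly_var_in_carrier: "i \<in> V \<Longrightarrow> mpoly_var i \<in> carrier (mpoly_ring V)"
  by (simp add: mpoly_ring_def mpoly_var_def)

text \<open>
  The \<open>R\<close>-module \<open>I/J\<close> for ideals \<open>J \<subseteq> I\<close>. The fields \<open>mult\<close> and \<open>one\<close> of the record play no
  role in a module.
\<close>

definition quotient_module ::
    "('a, 'b) ring_scheme \<Rightarrow> 'a set \<Rightarrow> 'a set \<Rightarrow> ('a, 'a set) module" where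
  "quotient_module R I J =
    \<lparr>carrier = (\<lambda>x. J +>\<^bsub>R\<^esub> x) ` I, monoid.mult = undefined, one = undefined,
     ring.zero = J, add = set_add R, smult = (\<lambda>r C. \<Union>x\<in>C. J +>\<^bsub>R\<^esub> (r \<otimes>\<^bsub>R\<^esub> x))\<rparr>"

lemma module_quotient_module:
  assumes "cring R" "ideal I R" "ideal J R" "J \<subseteq> I"
  shows "module R (quotient_module R I J)"
proof -
  interpret R: cring R by fact
  interpret I: ideal I R by fact
  interpret J: ideal J R by fact
  let ?M = "quotient_module R I J"
  have IR: "x \<in> carrier R" if "x \<in> I" for x
    using that by simp
  have sm: "a \<odot>\<^bsub>?M\<^esub> (J +>\<^bsub>R\<^esub> x) = J +>\<^bsub>R\<^esub> (a \<otimes>\<^bsub>R\<^esub> x)"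
    if a: "a \<in> carrier R" and x: "x \<in> carrier R" for a x
  proof -
    have "J +>\<^bsub>R\<^esub> (a \<otimes>\<^bsub>R\<^esub> y) = J +>\<^bsub>R\<^esub> (a \<otimes>\<^bsub>R\<^esub> x)" if y: "y \<in> J +>\<^bsub>R\<^esub> x" for y
    proof -
      obtain j where j: "j \<in> J" "y = j \<oplus>\<^bsub>R\<^esub> x"
        using y by (auto simp: a_r_coset_def')
      have "a \<otimes>\<^bsub>R\<^esub> y = a \<otimes>\<^bsub>R\<^esub> j \<oplus>\<^bsub>R\<^esub> a \<otimes>\<^bsub>R\<^esub> x"
        using j a x by (simp add: R.r_distr)
      moreover have "a \<otimes>\<^bsub>R\<^esub> j \<in> J"
        using j a by (simp add: J.I_l_closed)
      ultimately have "a \<otimes>\<^bsub>R\<^esub> y \<in> J +>\<^bsub>R\<^esub> (a \<otimes>\<^bsub>R\<^esub> x)"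
        by (auto simp: a_r_coset_def')
      then show ?thesis
        using a x J.a_repr_independence'[of "a \<otimes>\<^bsub>R\<^esub> y" "a \<otimes>\<^bsub>R\<^esub> x"] by simp
    qed
    then have "a \<odot>\<^bsub>?M\<^esub> (J +>\<^bsub>R\<^esub> x) = (\<Union>y\<in>J +>\<^bsub>R\<^esub> x. J +>\<^bsub>R\<^esub> (a \<otimes>\<^bsub>R\<^esub> x))"
      by (simp add: quotient_module_def)
    also have "\<dots> = J +>\<^bsub>R\<^esub> (a \<otimes>\<^bsub>R\<^esub> x)"
      using J.a_rcos_self[OF x] by auto
    finally show ?thesis .
  qed
  have ad: "(J +>\<^bsub>R\<^esub> x) \<oplus>\<^bsub>?M\<^esub> (J +>\<^bsub>R\<^esub> y) = J +>\<^bsub>R\<^esub> (x \<oplus>\<^bsub>R\<^esub> y)"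
    if "x \<in> carrier R" "y \<in> carrier R" for x y
    using that by (simp add: quotient_module_def J.a_rcos_sum)
  have ze: "\<zero>\<^bsub>?M\<^esub> = J +>\<^bsub>R\<^esub> \<zero>\<^bsub>R\<^esub>"
    using J.a_subset by (simp add: quotient_module_def)
  have ca: "carrier ?M = (\<lambda>x. J +>\<^bsub>R\<^esub> x) ` I"
    by (simp add: quotient_module_def)
  show ?thesis
  proof (rule moduleI)
    show "abelian_group ?M"
    proof (rule abelian_groupI)
      fix x assume "x \<in> carrier ?M"
      then obtain u where u: "u \<in> I" "x = J +>\<^bsub>R\<^esub> u"
        by (auto simp: ca)
      then have "(J +>\<^bsub>R\<^esub> (\<ominus>\<^bsub>R\<^esub> u)) \<oplus>\<^bsub>?M\<^esub> x = \<zero>\<^bsub>?M\<^esub>"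
        by (simp add: ad ze R.l_neg)
      then show "\<exists>y\<in>carrier ?M. y \<oplus>\<^bsub>?M\<^esub> x = \<zero>\<^bsub>?M\<^esub>"
        using u by (auto simp: ca)
    qed (auto simp: ca ad ze R.a_ac)
  qed (auto simp: ca ad sm R.l_distr R.r_distr R.m_assoc I.I_l_closed assms(1))
qed

definition generated_submodule ::
    "('a, 'c) ring_scheme \<Rightarrow> ('a, 'b, 'd) module_scheme \<Rightarrow> 'b set \<Rightarrow> 'b set" where
  "generated_submodule R M S = \<Inter>{N. submodule N R M \<and> S \<subseteq> N}"

text \<open>
  The family \<open>a 0, \<dots>, a n\<close> of elements of \<open>I/I\<^sup>2\<close> lifts to a set of generators of \<open>I\<close>.
\<close>

definition lifts_to_generators ::
    "('a, 'b) ring_scheme \<Rightarrow> 'a set \<Rightarrow> nat \<Rightarrow> (nat \<Rightarrow> 'a set) \<Rightarrow> bool" where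
  "lifts_to_generators R I n a \<longleftrightarrow>
    (\<exists>g. (\<forall>i\<le>n. g i \<in> I) \<and> I = Idl\<^bsub>R\<^esub> (g ` {..n}) \<and>
         (\<forall>i\<le>n. (I \<cdot>\<^bsub>R\<^esub> I) +>\<^bsub>R\<^esub> g i = a i))"

end

theory Submission
  imports Defs "HOL-Homology.Brouwer_Degree"
begin

text \<open>
  The given elements generate \<open>I/I\<^sup>2\<close> because \<open>f = (\<Sum>i. X\<^sub>i \<cdot> X\<^sub>i f) - f\<^sup>2\<close>.

  Suppose \<open>g\<^sub>i = X\<^sub>i f + c\<^sub>i f\<^sup>2\<close> generate \<open>I\<close>, and put \<open>h\<^sub>i = X\<^sub>i + c\<^sub>i f\<close>, so that \<open>g\<^sub>i = h\<^sub>i f\<close>.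
  The polynomial map \<open>h\<close> is the identity on the unit sphere. At a common zero of the \<open>h\<^sub>i\<close>
  all \<open>g\<^sub>i\<close> and hence \<open>f\<close> vanish, so the zero would lie on the sphere, where \<open>h\<close> is the
  identity; hence there is no common zero. Then \<open>(t, v) \<mapsto> h (t v) / \<parallel>h (t v)\<parallel>\<close> contracts the
  sphere to a point, which is impossible.
\<close>

section \<open>Evaluation of polynomials at points\<close>

text \<open>The point is an infinite sequence \<open>v\<close>, whatever variables occur in
  \<open>p\<close>, so that the points of \<open>nsphere n\<close>, which are functions on
  \<open>nat\<close>, can be inserted directly.\<close>

definition mpoly_eval :: "(nat \<Rightarrow> 'a::comm_ring_1) \<Rightarrow> ((nat \<Rightarrow>\<^sub>0 nat) \<Rightarrow>\<^sub>0 'a) \<Rightarrow> 'a" where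
  "mpoly_eval v p =
    (\<Sum>m\<in>Poly_Mapping.keys p. Poly_Mapping.lookup p m *
      (\<Prod>i\<in>Poly_Mapping.keys m. v i ^ Poly_Mapping.lookup m i))"

text \<open>Monomials outside the support have coefficient 0. This allows several polynomials to be
  summed over one common index set.\<close>

lemma mpoly_eval_superset:
  assumes "finite S" "Poly_Mapping.keys p \<subseteq> S"
  shows "mpoly_eval v p =
    (\<Sum>m\<in>S. Poly_Mapping.lookup p m * (\<Prod>i\<in>Poly_Mapping.keys m. v i ^ Poly_Mapping.lookup m i))"
  unfolding mpoly_eval_def using assms
  by (intro sum.mono_neutral_left) (auto simp: in_keys_iff)

lemma mpoly_eval_0 [simp]: "mpoly_eval v 0 = 0"
  by (simp add: mpoly_eval_def)

lemma mpoly_eval_add: "mpoly_eval v (p + q) = mpoly_eval v p + mpoly_eval v q"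
proof -
  let ?S = "Poly_Mapping.keys p \<union> Poly_Mapping.keys q"
  have "finite ?S" by simp
  then show ?thesis
    using Poly_Mapping.keys_add[of p q]
    by (simp add: mpoly_eval_superset[of ?S] lookup_add distrib_right sum.distrib)
qed

lemma mpoly_eval_uminus: "mpoly_eval v (- p) = - mpoly_eval v p"
  using mpoly_eval_add[of v p "- p"] by (simp add: eq_neg_iff_add_eq_0 add.commute)

lemma mpoly_eval_single:
  "mpoly_eval v (Poly_Mapping.single m c) =
    c * (\<Prod>i\<in>Poly_Mapping.keys m. v i ^ Poly_Mapping.lookup m i)"
  by (subst mpoly_eval_superset[of "{m}"]) auto

lemma mpoly_eval_1 [simp]: "mpoly_eval v 1 = 1"
  using mpoly_eval_single[of v 0 1] by simp

lemma mpoly_eval_var [simp]: "mpoly_eval v (mpoly_var i) = v i"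
  by (simp add: mpoly_var_def mpoly_eval_single)

text \<open>A factor with exponent 0 equals 1, so all three products can be taken over the union of
  the two supports, where \<open>power_add\<close> applies factor by factor.\<close>

lemma monomial_value_add:
  fixes v :: "nat \<Rightarrow> 'a::comm_ring_1"
  shows "(\<Prod>i\<in>Poly_Mapping.keys (a + b). v i ^ Poly_Mapping.lookup (a + b) i) =
    (\<Prod>i\<in>Poly_Mapping.keys a. v i ^ Poly_Mapping.lookup a i) *
    (\<Prod>i\<in>Poly_Mapping.keys b. v i ^ Poly_Mapping.lookup b i)"
proof -
  let ?S = "Poly_Mapping.keys a \<union> Poly_Mapping.keys b"
  have *: "(\<Prod>i\<in>Poly_Mapping.keys c. v i ^ Poly_Mapping.lookup c i) =
      (\<Prod>i\<in>?S. v i ^ Poly_Mapping.lookup c i)" if "Poly_Mapping.keys c \<subseteq> ?S" for c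
    using that by (intro prod.mono_neutral_left) (auto simp: in_keys_iff)
  show ?thesis
    using Poly_Mapping.keys_add[of a b]
    by (subst (1 2 3) *) (simp_all add: lookup_add power_add prod.distrib)
qed

text \<open>An induction rule fitted to additive maps: each step adds one monomial instead of
  overwriting one coefficient.\<close>

lemma poly_mapping_single_add_induct [case_names zero single_add]:
  assumes "P 0" and "\<And>k c p. P p \<Longrightarrow> P (Poly_Mapping.single k c + p)"
  shows "P p"
proof (induction p rule: update_induct)
  case const
  show ?case by (rule assms(1))
next
  case (update p k c)
  \<comment> \<open>The key \<open>k\<close> is new to \<open>p\<close>, so the old coefficient is 0
    and overwriting it is the same as adding \<open>c\<close>.\<close>
  then have "Poly_Mapping.update k c p = Poly_Mapping.single k c + p"
    by (intro poly_mapping_eqI)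
      (auto simp: lookup_add lookup_single lookup_update when_def in_keys_iff)
  with update show ?case by (simp add: assms(2))
qed

text \<open>Both sides are additive in each factor, so a nested induction reduces the claim to two
  monomials, where it is \<open>monomial_value_add\<close>.\<close>

lemma mpoly_eval_mult: "mpoly_eval v (p * q) = mpoly_eval v p * mpoly_eval v q"
proof (induction p rule: poly_mapping_single_add_induct)
  case (single_add k c p)
  have "mpoly_eval v (Poly_Mapping.single k c * q) =
      mpoly_eval v (Poly_Mapping.single k c) * mpoly_eval v q"
  proof (induction q rule: poly_mapping_single_add_induct)
    case (single_add l d q)
    then show ?case
      by (simp add: distrib_left mpoly_eval_add mult_single mpoly_eval_single monomial_value_add)
  qed simp
  with single_add show ?case
    by (simp add: distrib_right mpoly_eval_add)
qed simp

lemma continuous_map_mpoly_eval: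
  "continuous_map (powertop_real UNIV) euclideanreal (\<lambda>v. mpoly_eval v p)"
  unfolding mpoly_eval_def by (intro continuous_intros) auto

section \<open>Ring operations on polynomials and the ideal of a point\<close>

lemma mpoly_ring_simps:
  "add (mpoly_ring V) = (+)" "monoid.mult (mpoly_ring V) = (*)"
  "monoid.one (mpoly_ring V) = 1" "ring.zero (mpoly_ring V) = 0"
  by (simp_all add: mpoly_ring_def)

lemma a_inv_mpoly_ring:
  assumes "p \<in> carrier (mpoly_ring V)"
  shows "\<ominus>\<^bsub>mpoly_ring V\<^esub> p = - p"
proof -
  interpret cring "mpoly_ring V" by (rule cring_mpoly_ring)
  have "\<ominus>\<^bsub>mpoly_ring V\<^esub> p + p = 0"
    using l_neg[OF assms] by (simp add: mpoly_ring_simps)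
  then show ?thesis by (simp add: eq_neg_iff_add_eq_0)
qed

lemma a_minus_mpoly_ring:
  assumes "q \<in> carrier (mpoly_ring V)"
  shows "p \<ominus>\<^bsub>mpoly_ring V\<^esub> q = p - q"
  using a_inv_mpoly_ring[OF assms] by (simp add: a_minus_def mpoly_ring_simps)

text \<open>This is the kernel of evaluation at \<open>v\<close>. It serves to pass from generators
  that vanish at \<open>v\<close> to the whole ideal they generate.\<close>

lemma vanishing_ideal:
  "ideal {p \<in> carrier (mpoly_ring V). mpoly_eval v p = 0} (mpoly_ring V)"
proof -
  interpret cring "mpoly_ring V" by (rule cring_mpoly_ring)
  have cl: "p + q \<in> carrier (mpoly_ring V)" "p * q \<in> carrier (mpoly_ring V)"
      "0 \<in> carrier (mpoly_ring V)"
    if "p \<in> carrier (mpoly_ring V)" "q \<in> carrier (mpoly_ring V)" for p q :: "(nat \<Rightarrow>\<^sub>0 nat) \<Rightarrow>\<^sub>0 'a"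
    using a_closed[OF that] m_closed[OF that] zero_closed by (simp_all add: mpoly_ring_simps)
  have neg: "- p \<in> carrier (mpoly_ring V)" if "p \<in> carrier (mpoly_ring V)"
    for p :: "(nat \<Rightarrow>\<^sub>0 nat) \<Rightarrow>\<^sub>0 'a"
    using a_inv_closed[OF that] a_inv_mpoly_ring[OF that] by simp
  show ?thesis
  proof (rule idealI)
    show "subgroup {p \<in> carrier (mpoly_ring V). mpoly_eval v p = 0} (add_monoid (mpoly_ring V))"
      by (rule add.subgroupI)
        (auto simp: mpoly_ring_simps mpoly_eval_add mpoly_eval_uminus cl neg a_inv_mpoly_ring
          simp flip: a_inv_def intro!: exI[of _ 0] zero_closed[unfolded mpoly_ring_simps])
  qed (auto simp: mpoly_ring_simps mpoly_eval_mult cl ring_axioms)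
qed

section \<open>Extensions of the identity of the sphere have a zero\<close>

text \<open>A form of the no-retraction theorem: without a common zero, normalising \<open>h\<close>
  would retract the whole space onto the sphere, and the segments from the origin would make the
  identity of the sphere null-homotopic.\<close>

lemma exists_common_zero_of_sphere_identity_extension:
  fixes h :: "nat \<Rightarrow> (nat \<Rightarrow> real) \<Rightarrow> real"
  assumes cont: "\<And>i. i \<le> n \<Longrightarrow> continuous_map (powertop_real UNIV) euclideanreal (h i)"
    and id_on_sphere: "\<And>v i. v \<in> topspace (nsphere n) \<Longrightarrow> i \<le> n \<Longrightarrow> h i v = v i"
  shows "\<exists>v. \<forall>i\<le>n. h i v = 0"
proof (rule ccontr)
  assume no_zero: "\<not> ?thesis"
  define s where "s v = (\<Sum>i\<le>n. (h i v)\<^sup>2)" for v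
  have s_pos: "s v > 0" for v
  proof -
    obtain i where "i \<le> n" "h i v \<noteq> 0" using no_zero by blast
    then show ?thesis
      unfolding s_def by (intro sum_pos2[of _ i]) auto
  qed
  \<comment> \<open>The coordinates above \<open>n\<close> are set to 0 because the points of
    \<open>nsphere n\<close> vanish there.\<close>
  define r where "r v = (\<lambda>k. if k \<le> n then h k v / sqrt (s v) else 0)" for v
  have r_sphere: "r v \<in> topspace (nsphere n)" for v
  proof -
    have "(\<Sum>i\<le>n. (r v i)\<^sup>2) = s v / s v"
      using s_pos[of v] by (simp add: r_def power_divide s_def flip: sum_divide_distrib)
    then show ?thesis
      using s_pos[of v] by (auto simp: nsphere r_def)
  qed
  have r_id: "r v = v" if v: "v \<in> topspace (nsphere n)" for v
  proof -
    \<comment> \<open>On the sphere this sum is 1, so normalising changes nothing.\<close>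
    have "s v = (\<Sum>i\<le>n. (v i)\<^sup>2)"
      unfolding s_def using id_on_sphere[OF v] by simp
    with v show ?thesis
      by (auto simp: r_def nsphere id_on_sphere[OF v])
  qed
  let ?X = "prod_topology (top_of_set {0..1::real}) (nsphere n)"
  have "continuous_map ?X euclideanreal fst"
    using continuous_map_fst continuous_map_into_fulltopology by blast
  then have scale: "continuous_map ?X (powertop_real UNIV) (\<lambda>(t, v) i. t * v i)"
    unfolding continuous_map_componentwise_UNIV case_prod_unfold
    using continuous_map_compose[OF continuous_map_snd continuous_map_nsphere_projection]
    by (auto simp: o_def intro!: continuous_map_real_mult)
  have h_scale: "continuous_map ?X euclideanreal (\<lambda>z. h i ((\<lambda>(t, v) i. t * v i) z))" if "i \<le> n" for i
    using continuous_map_compose[OF scale cont[OF that]] by (simp add: o_def)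
  have "continuous_map ?X (nsphere n) (r \<circ> (\<lambda>(t, v) i. t * v i))"
  proof -
    have s_nz: "s w \<noteq> 0" for w
      using s_pos[of w] by simp
    have "continuous_map ?X euclideanreal (\<lambda>z. sqrt (s ((\<lambda>(t, v) i. t * v i) z)))"
      unfolding s_def by (intro continuous_intros h_scale) auto
    then have "continuous_map ?X euclideanreal (\<lambda>z. (r \<circ> (\<lambda>(t, v) i. t * v i)) z k)" for k
      by (cases "k \<le> n") (auto simp: r_def s_nz intro!: continuous_map_real_divide h_scale)
    then have "continuous_map ?X (powertop_real UNIV) (r \<circ> (\<lambda>(t, v) i. t * v i))"
      by (simp add: continuous_map_componentwise_UNIV)
    then show ?thesis
      using r_sphere unfolding nsphere by (auto simp: continuous_map_in_subtopology)
  qed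
  \<comment> \<open>At \<open>t = 0\<close> the map is constantly \<open>r\<close> of the origin; at
    \<open>t = 1\<close> it is \<open>r\<close> itself, which fixes the sphere pointwise.\<close>
  then have "homotopic_with (\<lambda>_. True) (nsphere n) (nsphere n) (\<lambda>_. r (\<lambda>_. 0)) id"
    by (subst homotopic_with, simp, intro exI[of _ "r \<circ> (\<lambda>(t, v) i. t * v i)"]) (auto simp: r_id)
  then have "contractible_space (nsphere n)"
    \<comment> \<open>Contractibility is defined by a homotopy from the identity to a constant,
      hence the reversal.\<close>
    unfolding contractible_space_def by (metis homotopic_with_symD)
  then show False
    using non_contractible_space_nsphere by blast
qed

section \<open>Cosets and submodules of a quotient \<open>I/J\<close>\<close>

text \<open>The scalar product is defined as a union over all representatives \<open>z\<close>;
  since \<open>J\<close> absorbs multiplication by \<open>r\<close>, every member of this union is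
  the same coset.\<close>

lemma coset_smult:
  assumes "cring R" "ideal J R" "r \<in> carrier R" "y \<in> carrier R"
  shows "r \<odot>\<^bsub>quotient_module R I J\<^esub> (J +>\<^bsub>R\<^esub> y) = J +>\<^bsub>R\<^esub> (r \<otimes>\<^bsub>R\<^esub> y)"
proof -
  interpret R: cring R by fact
  interpret J: ideal J R by fact
  have "J +>\<^bsub>R\<^esub> (r \<otimes>\<^bsub>R\<^esub> z) = J +>\<^bsub>R\<^esub> (r \<otimes>\<^bsub>R\<^esub> y)" if z: "z \<in> J +>\<^bsub>R\<^esub> y" for z
  proof -
    obtain j where j: "j \<in> J" "z = j \<oplus>\<^bsub>R\<^esub> y"
      using z by (auto simp: a_r_coset_def')
    then have "r \<otimes>\<^bsub>R\<^esub> z = r \<otimes>\<^bsub>R\<^esub> j \<oplus>\<^bsub>R\<^esub> r \<otimes>\<^bsub>R\<^esub> y" "r \<otimes>\<^bsub>R\<^esub> j \<in> J"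
      using assms by (simp_all add: R.r_distr J.I_l_closed)
    then have "r \<otimes>\<^bsub>R\<^esub> z \<in> J +>\<^bsub>R\<^esub> (r \<otimes>\<^bsub>R\<^esub> y)"
      by (auto simp: a_r_coset_def')
    then show ?thesis
      using assms J.a_repr_independence'[of "r \<otimes>\<^bsub>R\<^esub> z" "r \<otimes>\<^bsub>R\<^esub> y"] by simp
  qed
  \<comment> \<open>The coset contains \<open>y\<close>, so the union of the constant family is not
    empty.\<close>
  then have "(\<Union>z\<in>J +>\<^bsub>R\<^esub> y. J +>\<^bsub>R\<^esub> (r \<otimes>\<^bsub>R\<^esub> z)) = J +>\<^bsub>R\<^esub> (r \<otimes>\<^bsub>R\<^esub> y)"
    using J.a_rcos_self[OF assms(4)] by blast
  then show ?thesis
    by (simp add: quotient_module_def)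
qed

lemma coset_add:
  assumes "ideal J R" "y \<in> carrier R" "z \<in> carrier R"
  shows "(J +>\<^bsub>R\<^esub> y) \<oplus>\<^bsub>quotient_module R I J\<^esub> (J +>\<^bsub>R\<^esub> z) = J +>\<^bsub>R\<^esub> (y \<oplus>\<^bsub>R\<^esub> z)"
proof -
  interpret J: ideal J R by fact
  show ?thesis
    using assms by (simp add: quotient_module_def J.a_rcos_sum)
qed

text \<open>Used to show that a submodule containing the classes of the \<open>c i\<close> contains
  the class of any combination computed in the ring.\<close>

lemma coset_finsum_in_submodule:
  assumes "cring R" "ideal I R" "ideal J R" "J \<subseteq> I"
    and N: "submodule N R (quotient_module R I J)"
    and "finite S"
    and b: "\<And>i. i \<in> S \<Longrightarrow> b i \<in> carrier R" and c: "\<And>i. i \<in> S \<Longrightarrow> c i \<in> I"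
    and gen: "\<And>i. i \<in> S \<Longrightarrow> J +>\<^bsub>R\<^esub> c i \<in> N"
  shows "J +>\<^bsub>R\<^esub> (\<Oplus>\<^bsub>R\<^esub>i\<in>S. b i \<otimes>\<^bsub>R\<^esub> c i) \<in> N"
proof -
  interpret R: cring R by fact
  interpret I: ideal I R by fact
  interpret J: ideal J R by fact
  interpret N: submodule N R "quotient_module R I J" by fact
  \<comment> \<open>A submodule is a subgroup of the additive monoid, so \<open>one_closed\<close>
    speaks of zero and, below, \<open>m_closed\<close> of sums.\<close>
  have zero: "J +>\<^bsub>R\<^esub> \<zero>\<^bsub>R\<^esub> \<in> N"
    using N.one_closed J.a_subset by (simp add: quotient_module_def)
  show ?thesis
    using \<open>finite S\<close> b c gen
  proof (induction S rule: finite_induct)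
    case empty
    then show ?case by (simp add: zero)
  next
    case (insert i S)
    have bi: "b i \<in> carrier R" and ci: "c i \<in> carrier R"
      and rest: "\<And>j. j \<in> S \<Longrightarrow> b j \<in> carrier R" "\<And>j. j \<in> S \<Longrightarrow> c j \<in> carrier R"
      using insert.prems by auto
    have sum: "(\<Oplus>\<^bsub>R\<^esub>j\<in>S. b j \<otimes>\<^bsub>R\<^esub> c j) \<in> carrier R"
      using rest by (intro R.finsum_closed) auto
    have "J +>\<^bsub>R\<^esub> (b i \<otimes>\<^bsub>R\<^esub> c i) \<in> N"
      using N.smult_closed[OF bi insert.prems(3)[of i]] coset_smult[OF assms(1,3) bi ci] by simp
    moreover have "J +>\<^bsub>R\<^esub> (\<Oplus>\<^bsub>R\<^esub>j\<in>S. b j \<otimes>\<^bsub>R\<^esub> c j) \<in> N"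
      using insert.IH insert.prems by blast
    ultimately have "J +>\<^bsub>R\<^esub> (b i \<otimes>\<^bsub>R\<^esub> c i \<oplus>\<^bsub>R\<^esub> (\<Oplus>\<^bsub>R\<^esub>j\<in>S. b j \<otimes>\<^bsub>R\<^esub> c j)) \<in> N"
      using N.m_closed coset_add[OF assms(3), of "b i \<otimes>\<^bsub>R\<^esub> c i" "\<Oplus>\<^bsub>R\<^esub>j\<in>S. b j \<otimes>\<^bsub>R\<^esub> c j" I] sum bi ci
      by fastforce
    then show ?case
      using insert.hyps bi ci rest by (simp add: R.finsum_insert Pi_def)
  qed
qed

lemma submodule_carrier:
  assumes "module R M"
  shows "submodule (carrier M) R M"
proof -
  interpret module R M by fact
  show ?thesis by (rule submoduleI) auto
qed

text \<open>The carrier is itself one of the intersected submodules, which gives one inclusion; the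
  last premise gives the other.\<close>

lemma generated_submodule_eqI:
  assumes "module R M" "S \<subseteq> carrier M"
    and "\<And>N. submodule N R M \<Longrightarrow> S \<subseteq> N \<Longrightarrow> carrier M \<subseteq> N"
  shows "generated_submodule R M S = carrier M"
  using assms submodule_carrier[OF assms(1)] unfolding generated_submodule_def by blast

text \<open>Each product \<open>(b f)(c f)\<close> equals \<open>(b c)(f f)\<close>, and sums stay
  in the principal ideal. This writes an element of the square of \<open>PIdl f\<close> as a single
  multiple of \<open>f \<otimes> f\<close>.\<close>

lemma (in cring) ideal_prod_PIdl_subset:
  assumes f: "f \<in> carrier R"
  shows "(PIdl f) \<cdot> (PIdl f) \<subseteq> PIdl (f \<otimes> f)"
proof
  interpret P: ideal "PIdl (f \<otimes> f)" R
    using f by (intro cgenideal_ideal) auto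
  fix p assume "p \<in> (PIdl f) \<cdot> (PIdl f)"
  then show "p \<in> PIdl (f \<otimes> f)"
  proof induction
    case (prod i j)
    then obtain b c where bc: "b \<in> carrier R" "c \<in> carrier R" "i = b \<otimes> f" "j = c \<otimes> f"
      unfolding cgenideal_def by blast
    then have "i \<otimes> j = (b \<otimes> c) \<otimes> (f \<otimes> f)"
      using f by (simp add: m_ac)
    moreover have "b \<otimes> c \<in> carrier R"
      using bc by simp
    ultimately show ?case
      unfolding cgenideal_def by blast
  qed (rule P.a_closed)
qed

theorem mainTheorem2:
  fixes n :: nat
    and A :: "((nat \<Rightarrow>\<^sub>0 nat) \<Rightarrow>\<^sub>0 real) ring"
    and x :: "nat \<Rightarrow> (nat \<Rightarrow>\<^sub>0 nat) \<Rightarrow>\<^sub>0 real"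
    and f :: "(nat \<Rightarrow>\<^sub>0 nat) \<Rightarrow>\<^sub>0 real"
    and I :: "((nat \<Rightarrow>\<^sub>0 nat) \<Rightarrow>\<^sub>0 real) set"
    and a :: "nat \<Rightarrow> ((nat \<Rightarrow>\<^sub>0 nat) \<Rightarrow>\<^sub>0 real) set"
  assumes "n \<noteq> 0" "n \<noteq> 1" "n \<noteq> 3" "n \<noteq> 7"
    and "A = mpoly_ring {..n}"
    and "x = mpoly_var"
    and "f = (\<Oplus>\<^bsub>A\<^esub>i\<in>{..n}. x i [^]\<^bsub>A\<^esub> (2::nat)) \<ominus>\<^bsub>A\<^esub> \<one>\<^bsub>A\<^esub>"
    and "I = PIdl\<^bsub>A\<^esub> f"
    and "a = (\<lambda>i. (I \<cdot>\<^bsub>A\<^esub> I) +>\<^bsub>A\<^esub> (x i \<otimes>\<^bsub>A\<^esub> f))"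
  shows "generated_submodule A (quotient_module A I (I \<cdot>\<^bsub>A\<^esub> I)) (a ` {..n})
           = carrier (quotient_module A I (I \<cdot>\<^bsub>A\<^esub> I))
       \<and> \<not> lifts_to_generators A I n a
       \<and> \<not> (\<exists>g. (\<forall>i\<le>n. g i \<in> I) \<and> I = Idl\<^bsub>A\<^esub> (g ` {..n}) \<and>
               (\<forall>i\<le>n. g i \<ominus>\<^bsub>A\<^esub> x i \<otimes>\<^bsub>A\<^esub> f \<in> I \<cdot>\<^bsub>A\<^esub> I))"
proof -
  note A = assms(5) and x = assms(6) and f = assms(7) and I = assms(8) and a = assms(9)
  interpret A: cring A unfolding A by (rule cring_mpoly_ring)
  have ops: "add A = (+)" "monoid.mult A = (*)" "monoid.one A = 1" "ring.zero A = 0"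
    by (simp_all add: A mpoly_ring_simps)
  have xc: "x i \<in> carrier A" if "i \<le> n" for i
    using that by (simp add: A x mpoly_var_in_carrier)
  have sumc: "(\<Oplus>\<^bsub>A\<^esub>i\<in>{..n}. x i [^]\<^bsub>A\<^esub> (2::nat)) \<in> carrier A"
    using xc by (intro A.finsum_closed) auto
  have fc: "f \<in> carrier A"
    unfolding f using sumc by simp
  have minus: "p \<ominus>\<^bsub>A\<^esub> q = p - q" if "q \<in> carrier A" for p q
    using that a_minus_mpoly_ring unfolding A by blast
  have f_eq: "f = (\<Oplus>\<^bsub>A\<^esub>i\<in>{..n}. x i [^]\<^bsub>A\<^esub> (2::nat)) - 1"
    unfolding f using minus[OF A.one_closed] by (simp add: ops)
  interpret I: ideal I A
    unfolding I using fc by (rule A.cgenideal_ideal)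
  define J where "J = I \<cdot>\<^bsub>A\<^esub> I"
  interpret J: ideal J A
    unfolding J_def by (rule A.ideal_prod_is_ideal) (rule I.ideal_axioms)+
  have JI: "J \<subseteq> I"
    unfolding J_def using A.ideal_prod_inter[OF I.ideal_axioms I.ideal_axioms] by blast
  have fI: "f \<in> I"
    unfolding I using fc by (rule A.cgenideal_self)
  have xfI: "x i \<otimes>\<^bsub>A\<^esub> f \<in> I" if "i \<le> n" for i
    using I.I_l_closed[OF fI xc[OF that]] .
  have mod: "module A (quotient_module A I J)"
    by (rule module_quotient_module) (use A.is_cring I.ideal_axioms J.ideal_axioms JI in auto)

  \<comment> \<open>Generation of the quotient of \<open>I\<close> by its square\<close>
  have "generated_submodule A (quotient_module A I J) (a ` {..n}) = carrier (quotient_module A I J)"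
  proof (rule generated_submodule_eqI[OF mod])
    show "a ` {..n} \<subseteq> carrier (quotient_module A I J)"
      using xfI by (auto simp: quotient_module_def a J_def)
  next
    fix N assume N: "submodule N A (quotient_module A I J)" and aN: "a ` {..n} \<subseteq> N"
    show "carrier (quotient_module A I J) \<subseteq> N"
    proof
      fix C assume "C \<in> carrier (quotient_module A I J)"
      then obtain y where "y \<in> I" and Cy: "C = J +>\<^bsub>A\<^esub> y"
        by (auto simp: quotient_module_def)
      then obtain r where r: "r \<in> carrier A" and y: "y = r \<otimes>\<^bsub>A\<^esub> f"
        unfolding I cgenideal_def by blast
      note C = Cy[unfolded y]
      \<comment> \<open>The coefficients \<open>r x_i\<close> are chosen because the sum of the
        \<open>x_i^2\<close> is \<open>f + 1\<close>: then \<open>?s\<close> equals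
        \<open>r f + (r f) f\<close>, which differs from \<open>r f\<close> by an element of
        \<open>J\<close>.\<close>
      let ?s = "\<Oplus>\<^bsub>A\<^esub>i\<in>{..n}. (r \<otimes>\<^bsub>A\<^esub> x i) \<otimes>\<^bsub>A\<^esub> (x i \<otimes>\<^bsub>A\<^esub> f)"
      have sN: "J +>\<^bsub>A\<^esub> ?s \<in> N"
        using A.is_cring I.ideal_axioms J.ideal_axioms JI N
      proof (rule coset_finsum_in_submodule)
        fix i assume "i \<in> {..n}"
        then have i: "i \<le> n" by simp
        show "r \<otimes>\<^bsub>A\<^esub> x i \<in> carrier A"
          using r xc[OF i] by simp
        show "x i \<otimes>\<^bsub>A\<^esub> f \<in> I"
          using i by (rule xfI)
        have "a i \<in> N" using aN i by blast
        then show "J +>\<^bsub>A\<^esub> (x i \<otimes>\<^bsub>A\<^esub> f) \<in> N"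
          by (simp only: a J_def)
      qed simp
      have "?s = (\<Oplus>\<^bsub>A\<^esub>i\<in>{..n}. r \<otimes>\<^bsub>A\<^esub> f \<otimes>\<^bsub>A\<^esub> (x i [^]\<^bsub>A\<^esub> (2::nat)))"
        using xc r fc by (intro A.finsum_cong') (auto simp: numeral_2_eq_2 A.m_ac)
      also have "\<dots> = r \<otimes>\<^bsub>A\<^esub> f \<otimes>\<^bsub>A\<^esub> (\<Oplus>\<^bsub>A\<^esub>i\<in>{..n}. x i [^]\<^bsub>A\<^esub> (2::nat))"
        using xc r fc by (subst A.finsum_rdistr) auto
      also have "(\<Oplus>\<^bsub>A\<^esub>i\<in>{..n}. x i [^]\<^bsub>A\<^esub> (2::nat)) = f + 1"
        by (simp add: f_eq)
      finally have "?s = (r \<otimes>\<^bsub>A\<^esub> f) \<otimes>\<^bsub>A\<^esub> f \<oplus>\<^bsub>A\<^esub> r \<otimes>\<^bsub>A\<^esub> f"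
        by (simp add: ops distrib_left)
      moreover have "(r \<otimes>\<^bsub>A\<^esub> f) \<otimes>\<^bsub>A\<^esub> f \<in> J"
        unfolding J_def using I.I_l_closed[OF fI r] fI by (rule ideal_prod.prod)
      ultimately have "?s \<in> J +>\<^bsub>A\<^esub> (r \<otimes>\<^bsub>A\<^esub> f)"
        by (auto simp: a_r_coset_def')
      then have "J +>\<^bsub>A\<^esub> ?s = C"
        using J.a_repr_independence'[of ?s "r \<otimes>\<^bsub>A\<^esub> f"] r fc C by simp
      with sN show "C \<in> N" by simp
    qed
  qed

  \<comment> \<open>Impossibility of a lift\<close>
  moreover have no_lift: False
    if gI: "\<forall>i\<le>n. g i \<in> I" and gen: "I = Idl\<^bsub>A\<^esub> (g ` {..n})"
      and cong: "\<forall>i\<le>n. g i \<ominus>\<^bsub>A\<^esub> x i \<otimes>\<^bsub>A\<^esub> f \<in> J" for g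
  proof -
    have eval_f: "mpoly_eval v f = (\<Sum>i\<le>n. (v i)\<^sup>2) - 1" for v
    proof -
      \<comment> \<open>Generalised from \<open>{..n}\<close> to its subsets to allow induction on
        the index set.\<close>
      have "mpoly_eval v (\<Oplus>\<^bsub>A\<^esub>i\<in>S. x i [^]\<^bsub>A\<^esub> (2::nat)) = (\<Sum>i\<in>S. (v i)\<^sup>2)"
        if "finite S" "S \<subseteq> {..n}" for S
        using that
      proof (induction S rule: finite_induct)
        case empty
        then show ?case using A.finsum_empty by (simp add: ops)
      next
        case (insert i S)
        then have "(\<Oplus>\<^bsub>A\<^esub>j\<in>insert i S. x j [^]\<^bsub>A\<^esub> (2::nat)) =
            x i [^]\<^bsub>A\<^esub> (2::nat) \<oplus>\<^bsub>A\<^esub> (\<Oplus>\<^bsub>A\<^esub>j\<in>S. x j [^]\<^bsub>A\<^esub> (2::nat))"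
          using xc by (intro A.finsum_insert) auto
        moreover have "x i [^]\<^bsub>A\<^esub> (2::nat) = x i * x i"
          using insert.prems xc by (simp add: numeral_2_eq_2 ops)
        ultimately show ?case
          using insert by (simp add: ops mpoly_eval_add mpoly_eval_mult x power2_eq_square)
      qed
      then show ?thesis
        \<comment> \<open>Here \<open>f + 1\<close> is the sum of squares just evaluated.\<close>
        using mpoly_eval_add[of v f 1] by (simp add: f_eq)
    qed
    have "\<exists>c. g i = (x i + c * f) * f" if i: "i \<le> n" for i
    proof -
      have "g i \<ominus>\<^bsub>A\<^esub> x i \<otimes>\<^bsub>A\<^esub> f \<in> PIdl\<^bsub>A\<^esub> (f \<otimes>\<^bsub>A\<^esub> f)"
        using cong i A.ideal_prod_PIdl_subset[OF fc] unfolding J_def I by blast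
      then obtain c where "g i \<ominus>\<^bsub>A\<^esub> x i \<otimes>\<^bsub>A\<^esub> f = c \<otimes>\<^bsub>A\<^esub> (f \<otimes>\<^bsub>A\<^esub> f)"
        unfolding cgenideal_def by blast
      moreover have "g i \<ominus>\<^bsub>A\<^esub> x i \<otimes>\<^bsub>A\<^esub> f = g i - x i \<otimes>\<^bsub>A\<^esub> f"
        using xc[OF i] fc by (intro minus) simp
      ultimately have "g i = (x i + c * f) * f"
        by (simp add: ops algebra_simps)
      then show ?thesis ..
    qed
    then obtain c where c: "\<And>i. i \<le> n \<Longrightarrow> g i = (x i + c i * f) * f"
      by metis
    define h where "h i v = mpoly_eval v (x i + c i * f)" for i v
    \<comment> \<open>Stated for every zero of \<open>f\<close>, since it is applied both on
      \<open>nsphere n\<close> and to the common zero \<open>v\<close> below, whose coordinates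
      above \<open>n\<close> are not controlled.\<close>
    have h_sphere: "h i v = v i" if "mpoly_eval v f = 0" for i v
      using that by (simp add: h_def mpoly_eval_add mpoly_eval_mult x)
    have "\<exists>v. \<forall>i\<le>n. h i v = 0"
    proof (rule exists_common_zero_of_sphere_identity_extension)
      show "continuous_map (powertop_real UNIV) euclideanreal (h i)" for i
        unfolding h_def by (rule continuous_map_mpoly_eval)
      show "h i v = v i" if "v \<in> topspace (nsphere n)" for i v
        using that by (intro h_sphere) (simp add: eval_f nsphere)
    qed
    then obtain v where v: "\<And>i. i \<le> n \<Longrightarrow> h i v = 0" by blast
    have "mpoly_eval v (g i) = 0" if "i \<le> n" for i
      using v[OF that] c[OF that] by (simp add: h_def mpoly_eval_mult)
    then have "g ` {..n} \<subseteq> {p \<in> carrier A. mpoly_eval v p = 0}"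
      using gI by auto
    \<comment> \<open>The \<open>g i\<close> generate \<open>I\<close>, so their common zero is a
      zero of all of \<open>I\<close>, in particular of \<open>f\<close>.\<close>
    then have "I \<subseteq> {p \<in> carrier A. mpoly_eval v p = 0}"
      unfolding gen using A.genideal_minimal[OF vanishing_ideal[of "{..n}" v, folded A]] by blast
    then have "mpoly_eval v f = 0"
      using fI by blast
    moreover from this have "v i = 0" if "i \<le> n" for i
      using v[OF that] h_sphere by simp
    \<comment> \<open>With \<open>v i = 0\<close> for all \<open>i \<le> n\<close>, the value of
      \<open>f\<close> at \<open>v\<close> is \<open>-1\<close>, not 0.\<close>
    ultimately show False by (simp add: eval_f)
  qed
  moreover have "\<not> lifts_to_generators A I n a"
  proof
    assume "lifts_to_generators A I n a"
    then obtain g where gI: "\<forall>i\<le>n. g i \<in> I" and gen: "I = Idl\<^bsub>A\<^esub> (g ` {..n})"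
      and coset: "\<forall>i\<le>n. J +>\<^bsub>A\<^esub> g i = J +>\<^bsub>A\<^esub> (x i \<otimes>\<^bsub>A\<^esub> f)"
      by (auto simp: lifts_to_generators_def a J_def)
    \<comment> \<open>Two elements have the same coset exactly when their difference lies in
      \<open>J\<close>, so a lift in terms of cosets is one in terms of congruences.\<close>
    have "g i \<ominus>\<^bsub>A\<^esub> x i \<otimes>\<^bsub>A\<^esub> f \<in> J" if i: "i \<le> n" for i
      using A.quotient_eq_iff_same_a_r_cos[OF J.ideal_axioms] coset gI xfI i I.Icarr by simp
    with gI gen show False using no_lift by blast
  qed
  ultimately show ?thesis
    unfolding J_def by blast
qed

end
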